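(* Let $G=C_N$ be the cycle graph on $N\geq3$ nodes and let $t\in\{1,\ldots,N\}$. Then $\chi_t(C_N)=\gcd(t,N)$.
   Context: All graphs are finite, simple and connected. A path of length $t$ is a sequence $v_1,\ldots,v_{t+1}$ of distinct vertices with $v_j\sim v_{j+1}$ for all $j$; its endpoints are $v_1$ and $v_{t+1}$. A (not necessarily proper) colouring of the vertices of $G$ is $t$-periodic if every path of length $t$ in $G$ has endpoints of the same colour. The vertex $t$-periodic colouring number $\chi_t(G)$ is the largest $k$ such that $G$ has a $t$-periodic colouring of the vertices using exactly $k$ colours. *)

theory Defs
  imports "Graph_Theory.Graph_Theory"
begin

text \<open>
  As in the underlying library, a finite simple graph is a finite symmetric digraph without loops
  or parallel arcs. The endpoints of a path given by its vertex list are the head and the last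
  element of the list, and its length is the number of its edges.
\<close>

definition periodic_colouring :: "nat \<Rightarrow> ('a, 'b) pre_digraph \<Rightarrow> ('a \<Rightarrow> 'c) \<Rightarrow> bool" where
  "periodic_colouring t G c \<longleftrightarrow>
     (\<forall>p. vpath p G \<and> vwalk_length p = t \<longrightarrow> c (hd p) = c (last p))"

text \<open>
  Natural numbers serve as colours; this is no restriction for finite graphs. The number of
  colours used is counted on the vertices of the graph only. The maximum is taken over a finite
  nonempty set whenever the graph is finite, see the two lemmas below.
\<close>

definition periodic_colour_counts :: "nat \<Rightarrow> ('a, 'b) pre_digraph \<Rightarrow> nat set" where
  "periodic_colour_counts t G =
     {card (c ` verts G) | c :: 'a \<Rightarrow> nat. periodic_colouring t G c}"

definition periodic_colouring_number :: "nat \<Rightarrow> ('a, 'b) pre_digraph \<Rightarrow> nat" where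
  "periodic_colouring_number t G = Max (periodic_colour_counts t G)"

lemma finite_periodic_colour_counts:
  assumes "finite (verts G)"
  shows "finite (periodic_colour_counts t G)"
proof (rule finite_subset)
  show "periodic_colour_counts t G \<subseteq> {..card (verts G)}"
    using assms by (auto simp: periodic_colour_counts_def card_image_le)
qed simp

lemma periodic_colour_counts_nonempty: "periodic_colour_counts t G \<noteq> {}"
proof -
  have "periodic_colouring t G (\<lambda>_. 0 :: nat)"
    by (simp add: periodic_colouring_def)
  then show ?thesis
    by (auto simp: periodic_colour_counts_def)
qed

text \<open>
  The cycle on the vertices \<open>0, \<dots>, n - 1\<close>; it is a simple graph, and the usual cycle, only for
  \<open>n \<ge> 3\<close>.
\<close>

definition cycle_graph :: "nat \<Rightarrow> nat pair_pre_digraph" where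
  "cycle_graph n =
     \<lparr> pverts = {0..<n},
       parcs = {(i, j). i < n \<and> j < n \<and> (j = Suc i mod n \<or> i = Suc j mod n)} \<rparr>"

lemma pair_graph_cycle_graph:
  assumes "n \<ge> 3"
  shows "pair_graph (cycle_graph n)"
proof
  show "finite (parcs (cycle_graph n))"
    by (rule finite_subset[of _ "{0..<n} \<times> {0..<n}"]) (auto simp: cycle_graph_def)
  show "symmetric (with_proj (cycle_graph n))"
    by (auto simp: symmetric_def sym_def cycle_graph_def)
  show "fst e \<noteq> snd e" if "e \<in> parcs (cycle_graph n)" for e
    using that assms by (auto simp: cycle_graph_def mod_Suc split: if_splits)
qed (auto simp: cycle_graph_def)

lemma connected_cycle_graph:
  assumes "n \<ge> 3"
  shows "connected (with_proj (cycle_graph n))"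
proof -
  interpret pair_graph "cycle_graph n"
    by (rule pair_graph_cycle_graph[OF assms])
  have reach: "0 \<rightarrow>\<^sup>*\<^bsub>with_proj (cycle_graph n)\<^esub> i" if "i < n" for i
    using that
  proof (induction i)
    case 0
    then have "0 \<in> pverts (cycle_graph n)" by (simp add: cycle_graph_def)
    then show ?case by (rule reachable_refl)
  next
    case (Suc i)
    have "(i, Suc i) \<in> parcs (cycle_graph n)"
      using Suc.prems by (simp add: cycle_graph_def)
    moreover have "0 \<rightarrow>\<^sup>*\<^bsub>with_proj (cycle_graph n)\<^esub> i"
      using Suc by simp
    ultimately show ?case
      by (rule reachable_adj_trans[rotated])
  qed
  show ?thesis
  proof (rule connectedI)
    show "pverts (cycle_graph n) \<noteq> {}"
      using assms by (simp add: cycle_graph_def)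
    fix u v assume "u \<in> pverts (cycle_graph n)" "v \<in> pverts (cycle_graph n)"
    then have "u < n" "v < n" by (auto simp: cycle_graph_def)
    then have "u \<rightarrow>\<^sup>*\<^bsub>with_proj (cycle_graph n)\<^esub> v"
      using reach symmetric_reachable pair_sym_arcs reachable_trans by meson
    then show "u \<rightarrow>\<^sup>*\<^bsub>with_proj (mk_symmetric (with_proj (cycle_graph n)))\<^esub> v"
      by (rule reachable_mk_symmetricI)
  qed
qed

end

theory Submission
  imports Defs
begin

text \<open>
  A path in \<open>C\<^sub>N\<close> cannot turn back, so the endpoints of a path of length \<open>t\<close> differ by exactly \<open>t\<close>
  modulo \<open>N\<close>. Hence colouring by the residue modulo \<open>gcd t N\<close> is \<open>t\<close>-periodic. Conversely, for
  \<open>t < N\<close> walking \<open>t\<close> steps around the cycle is a path, so a \<open>t\<close>-periodic colouring is invariant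
  under translation by \<open>t\<close>, hence by Bezout under translation by \<open>gcd t N\<close>. For \<open>t = N\<close> there is
  no path of length \<open>t\<close> and \<open>gcd t N\<close> is the number of vertices.
\<close>

lemma Suc_mod_inj:
  fixes x y n :: nat
  assumes "x < n" "y < n" "Suc x mod n = Suc y mod n"
  shows "x = y"
  using assms by (auto simp: mod_Suc split: if_splits)

lemma vpath_cycle_graph_Cons_Cons:
  "vpath (x # y # q) (with_proj (cycle_graph n)) \<longleftrightarrow>
     x < n \<and> (y = Suc x mod n \<or> x = Suc y mod n) \<and> x \<notin> set (y # q) \<and>
     vpath (y # q) (with_proj (cycle_graph n))"
  by (auto simp: vpath_def vwalk_def cycle_graph_def)

text \<open>Once the first edge goes up, distinctness forces every later edge up as well, so each
  edge adds one modulo \<open>n\<close>.\<close>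

lemma vpath_cycle_graph_forward:
  assumes "vpath (x # y # q) (with_proj (cycle_graph n))" "y = Suc x mod n"
  shows "last (y # q) = (x + Suc (length q)) mod n"
  using assms
proof (induction q arbitrary: x y)
  case (Cons z q)
  \<comment> \<open>Otherwise \<open>Suc z mod n = y = Suc x mod n\<close>, and
    \<open>Suc_mod_inj\<close> gives \<open>z = x\<close>, a repeated vertex.\<close>
  have "z = Suc y mod n"
    using Cons.prems Suc_mod_inj[of x n z]
    by (auto simp: vpath_cycle_graph_Cons_Cons vpath_def vwalk_def cycle_graph_def)
  moreover have "vpath (y # z # q) (with_proj (cycle_graph n))"
    using Cons.prems(1) vpath_cycle_graph_Cons_Cons by blast
  ultimately have "last (z # q) = (y + Suc (length q)) mod n"
    using Cons.IH by blast
  also have "\<dots> = (x + Suc (length (z # q))) mod n"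
    using mod_add_left_eq[of "Suc x" n "Suc (length q)"] by (simp add: Cons.prems(2))
  finally show ?case by simp
qed simp

text \<open>Mirror image for descending paths. Solving for the start \<open>x\<close> instead of the
  last vertex avoids subtraction modulo \<open>n\<close>.\<close>

lemma vpath_cycle_graph_backward:
  assumes "vpath (x # y # q) (with_proj (cycle_graph n))" "x = Suc y mod n"
  shows "x = (last (y # q) + Suc (length q)) mod n"
  using assms
proof (induction q arbitrary: x y)
  case (Cons z q)
  have "y = Suc z mod n"
    using Cons.prems by (auto simp: vpath_cycle_graph_Cons_Cons)
  moreover have "vpath (y # z # q) (with_proj (cycle_graph n))"
    using Cons.prems(1) vpath_cycle_graph_Cons_Cons by blast
  ultimately have y: "y = (last (z # q) + Suc (length q)) mod n"
    using Cons.IH by blast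
  have "x = Suc ((last (z # q) + Suc (length q)) mod n) mod n"
    using Cons.prems(2) y by simp
  also have "\<dots> = (last (z # q) + Suc (length (z # q))) mod n"
    by (simp add: mod_simps)
  finally show ?case by simp
qed simp

lemma periodic_colouring_mod:
  assumes "t \<ge> 1"
  shows "periodic_colouring t (with_proj (cycle_graph n)) (\<lambda>i. i mod gcd t n)"
  unfolding periodic_colouring_def
proof (intro allI impI)
  have mod: "(i + t) mod n mod gcd t n = i mod gcd t n" for i :: nat
    by (metis add.right_neutral dvd_imp_mod_0 gcd_dvd1 gcd_dvd2 mod_add_right_eq mod_mod_cancel)
  fix p assume p: "vpath p (with_proj (cycle_graph n)) \<and> vwalk_length p = t"
  obtain x y q where pq: "p = x # y # q"
    using p assms by (cases p rule: vwalk_arcs.cases) auto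
  have t: "t = Suc (length q)" using p pq by simp
  have "last p = (hd p + t) mod n \<or> hd p = (last p + t) mod n"
    using vpath_cycle_graph_forward[of x y q n] vpath_cycle_graph_backward[of x y q n] p pq t
      vpath_cycle_graph_Cons_Cons[of x y q n] by auto
  then show "hd p mod gcd t n = last p mod gcd t n"
    using mod by metis
qed

text \<open>Fewer than \<open>n\<close> steps never return to the start. The induction varies
  \<open>i\<close> because dropping the first vertex leaves the shorter arc that starts at
  \<open>Suc i mod n\<close>.\<close>

lemma vpath_cycle_graph_arc:
  assumes "i < n" "t < n"
  shows "vpath (map (\<lambda>k. (i + k) mod n) [0..<Suc t]) (with_proj (cycle_graph n))"
  using assms
proof (induction t arbitrary: i)
  case 0
  then show ?case by (simp add: vpath_def vwalk_def cycle_graph_def)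
next
  case (Suc t)
  \<comment> \<open>Peels off one vertex; the cases \<open>m = 0\<close> and \<open>m = 1\<close>
    expose the two leading vertices that \<open>vpath_cycle_graph_Cons_Cons\<close> expects.\<close>
  have shift: "map (\<lambda>k. (i + k) mod n) [m..<Suc (m + s)] =
      (i + m) mod n # map (\<lambda>k. (i + k) mod n) [Suc m..<Suc (m + s)]" for m s
    by (subst upt_conv_Cons) auto
  have "map (\<lambda>k. (Suc i mod n + k) mod n) [0..<Suc t] = map (\<lambda>k. (i + k) mod n) [1..<Suc (Suc t)]"
    by (simp only: One_nat_def map_Suc_upt[symmetric] map_map o_def) (simp add: mod_simps)
  also have "\<dots> = Suc i mod n # map (\<lambda>k. (i + k) mod n) [2..<Suc (Suc t)]"
    using shift[of 1 t] by (simp add: numeral_2_eq_2 del: upt_Suc)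
  finally have tail: "map (\<lambda>k. (Suc i mod n + k) mod n) [0..<Suc t] =
      Suc i mod n # map (\<lambda>k. (i + k) mod n) [2..<Suc (Suc t)]" .
  have "vpath (map (\<lambda>k. (Suc i mod n + k) mod n) [0..<Suc t]) (with_proj (cycle_graph n))"
    using Suc by simp
  then have path: "vpath (Suc i mod n # map (\<lambda>k. (i + k) mod n) [2..<Suc (Suc t)])
      (with_proj (cycle_graph n))"
    by (simp only: tail)
  have avoid: "i \<noteq> (i + k) mod n" if "k \<ge> 1" "k < n" for k
    using that Suc.prems(1) by (cases "i + k < n") (auto simp: not_less le_mod_geq)
  have "i \<notin> set (Suc i mod n # map (\<lambda>k. (i + k) mod n) [2..<Suc (Suc t)])"
    using Suc.prems(2) avoid avoid[of 1] by (auto simp del: upt_Suc)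
  then have "vpath (i # Suc i mod n # map (\<lambda>k. (i + k) mod n) [2..<Suc (Suc t)])
      (with_proj (cycle_graph n))"
    using path Suc.prems(1) by (simp add: vpath_cycle_graph_Cons_Cons del: upt_Suc)
  moreover have "map (\<lambda>k. (i + k) mod n) [0..<Suc (Suc t)] =
      i # Suc i mod n # map (\<lambda>k. (i + k) mod n) [2..<Suc (Suc t)]"
    using shift[of 0 "Suc t"] shift[of 1 t] Suc.prems(1)
    by (simp add: numeral_2_eq_2 del: upt_Suc)
  ultimately show ?case by simp
qed

lemma periodic_colouring_cycle_graph_gcd:
  assumes c: "periodic_colouring t (with_proj (cycle_graph n)) c"
    and "1 \<le> t" "t < n" "i < n"
  shows "c (i mod gcd t n) = c i"
proof -
  have step: "c ((i + t) mod n) = c i" if "i < n" for i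
    using c vpath_cycle_graph_arc[OF that \<open>t < n\<close>] that
    by (auto simp: periodic_colouring_def last_map hd_map simp del: upt_Suc
          dest!: spec[of _ "map (\<lambda>k. (i + k) mod n) [0..<Suc t]"])
  \<comment> \<open>Since \<open>t * k\<close> may exceed \<open>n\<close>, this chains
    \<open>k\<close> paths of length \<open>t\<close> instead of using one long path.\<close>
  have steps: "c ((i + t * k) mod n) = c i" if "i < n" for i k
  proof (induction k)
    case (Suc k)
    have "(i + t * Suc k) mod n = ((i + t * k) mod n + t) mod n"
      by (simp add: mod_simps algebra_simps)
    then show ?case
      using Suc step[of "(i + t * k) mod n"] that by simp
  qed (use that in simp)
  \<comment> \<open>Modulo \<open>n\<close>, \<open>x\<close> translations by \<open>t\<close>
    amount to one by \<open>gcd t n\<close>. This subtraction-free form of Bezout needs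
    \<open>t\<close> nonzero.\<close>
  obtain x y where xy: "t * x = n * y + gcd t n"
    using bezout_nat[of t n] \<open>1 \<le> t\<close> by auto
  have "c ((j + gcd t n * k) mod n) = c j" if "j < n" for j k
  proof -
    have "(j + t * (x * k)) mod n = (j + gcd t n * k + n * (y * k)) mod n"
      by (metis (no_types, opaque_lifting) xy add.assoc add.commute distrib_right mult.assoc)
    then show ?thesis
      using steps[OF that, of "x * k"] by simp
  qed
  \<comment> \<open>From the residue of \<open>i\<close>, \<open>i div gcd t n\<close> translations
    by the gcd lead to \<open>i\<close> itself; as \<open>i < n\<close>, nothing wraps
    around.\<close>
  from this[of "i mod gcd t n" "i div gcd t n"] \<open>i < n\<close> show ?thesis
    using le_less_trans[OF mod_less_eq_dividend \<open>i < n\<close>, of "gcd t n"] by simp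
qed

lemma card_periodic_colouring_cycle_graph_le:
  assumes "periodic_colouring t (with_proj (cycle_graph n)) c" "1 \<le> t" "t \<le> n"
  shows "card (c ` {0..<n}) \<le> gcd t n"
proof (cases "t = n")
  case True
  then show ?thesis using card_image_le[of "{0..<n}" c] by simp
next
  case False
  have "c ` {0..<n} \<subseteq> c ` {0..<gcd t n}"
  proof (rule image_subsetI)
    fix i assume "i \<in> {0..<n}"
    then have "c i = c (i mod gcd t n)"
      using periodic_colouring_cycle_graph_gcd[OF assms(1,2), of i] False assms(3) by simp
    moreover have "i mod gcd t n \<in> {0..<gcd t n}"
      using assms(2) by simp
    ultimately show "c i \<in> c ` {0..<gcd t n}" by blast
  qed
  then have "card (c ` {0..<n}) \<le> card (c ` {0..<gcd t n})"
    by (intro card_mono) auto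
  also have "\<dots> \<le> gcd t n"
    using card_image_le[of "{0..<gcd t n}" c] by simp
  finally show ?thesis .
qed

theorem theorem4p5:
  fixes N t :: nat
  assumes "N \<ge> 3"
    and "t \<in> {1..N}"
  shows "periodic_colouring_number t (with_proj (cycle_graph N)) = gcd t N"
  unfolding periodic_colouring_number_def
proof (rule Max_eqI)
  have t: "1 \<le> t" "t \<le> N" using assms(2) by auto
  have verts: "verts (with_proj (cycle_graph N)) = {0..<N}"
    by (simp add: cycle_graph_def)
  show "finite (periodic_colour_counts t (with_proj (cycle_graph N)))"
    by (rule finite_periodic_colour_counts) (simp only: verts finite_atLeastLessThan)
  show "k \<le> gcd t N" if "k \<in> periodic_colour_counts t (with_proj (cycle_graph N))" for k
    using that card_periodic_colouring_cycle_graph_le t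
    unfolding periodic_colour_counts_def verts by blast
  have "gcd t N \<le> N" using assms(1) by (intro dvd_imp_le) auto
  \<comment> \<open>Every residue occurs as a colour, since it is itself a vertex by
    \<open>gcd t N \<le> N\<close>.\<close>
  have "(\<lambda>i. i mod gcd t N) ` {0..<N} = {0..<gcd t N}"
  proof
    show "(\<lambda>i. i mod gcd t N) ` {0..<N} \<subseteq> {0..<gcd t N}"
      using t by auto
    show "{0..<gcd t N} \<subseteq> (\<lambda>i. i mod gcd t N) ` {0..<N}"
    proof
      fix r assume "r \<in> {0..<gcd t N}"
      then have "r = r mod gcd t N" "r \<in> {0..<N}"
        using \<open>gcd t N \<le> N\<close> by auto
      then show "r \<in> (\<lambda>i. i mod gcd t N) ` {0..<N}"
        by (rule image_eqI)
    qed
  qed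
  then have "gcd t N = card ((\<lambda>i. i mod gcd t N) ` {0..<N})" by simp
  then show "gcd t N \<in> periodic_colour_counts t (with_proj (cycle_graph N))"
    using periodic_colouring_mod[OF t(1)]
    unfolding periodic_colour_counts_def verts by blast
qed

end
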